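(* Let $(\mathfrak{g}_-,h_-)$ be a flat pseudo-Riemannian Lie algebra of dimension $n$ with Levi-Civita connection $\nabla^-$. Let $\mathfrak{g}_+=\mathbb{R}^n$ (abelian), let $Q\colon\mathfrak{g}_+\to\mathfrak{g}_-$ be an isomorphism of vector spaces, set $h_+=Q^*h_-$, and define $\varphi\colon\mathfrak{g}_-\to\mathrm{Der}(\mathfrak{g}_+)$ by $\varphi(X_-)=Q^{-1}\nabla^-_{X_-}Q$. Then the Born structure on $\mathfrak{g}_+\rtimes_\varphi\mathfrak{g}_-$ associated with the data $(\mathfrak{g}_\pm,h_\pm,Q,\varphi)$ is integrable. Moreover, the metric $h=h_+\oplus h_-$ is flat.
   Context: All Lie algebras are real and finite-dimensional. A pseudo-Riemannian metric on a Lie algebra is a non-degenerate symmetric bilinear form of arbitrary signature; it is flat if the curvature of its Levi-Civita connection (given by the Koszul formula on the Lie algebra) vanishes. Born structures. For non-degenerate bilinear forms $a,b$ on a vector space, the recursion operator from $a$ to $b$ is the unique invertible endomorphism $A$ with $a(A\cdot,\cdot)=b(\cdot,\cdot)$. A Born structure on a Lie algebra $\mathfrak{g}$ is a triple $(g,h,\omega)$ of two pseudo-Riemannian metrics $g,h$ and a non-degenerate two-form $\omega$ such that the recursion operators $A$ from $g$ to $\omega$, $B$ from $g$ to $h$ and $-J$ from $\omega$ to $h$ satisfy $A^2=B^2=-J^2=\mathrm{Id}$. It is integrable if $\omega$ is closed under the Chevalley–Eilenberg differential, the Nijenhuis tensor of $J$ vanishes, and the $\pm1$-eigenspaces of $A$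 are subalgebras. A Born structure is equivalently encoded as $(h,J,\mathfrak{g}_\pm)$, where $J^2=-\mathrm{Id}$, $h(J\cdot,J\cdot)=h$, and $\mathfrak{g}=\mathfrak{g}_+\oplus\mathfrak{g}_-$ is an $h$-orthogonal splitting whose summands (the $\pm1$-eigenspaces of $A$) are interchanged by $J$; then $\omega=h(J\cdot,\cdot)$ and $g=\omega(A\cdot,\cdot)$. Semidirect product. For a representation $\varphi\colon\mathfrak{g}_-\to\mathrm{Der}(\mathfrak{g}_+)$, $\mathfrak{g}_+\rtimes_\varphi\mathfrak{g}_-$ is the Lie algebra on $\mathfrak{g}_+\oplus\mathfrak{g}_-$ with bracket $[X_++X_-,Y_++Y_-]=[X_+,Y_+]_++\varphi(X_-)Y_+-\varphi(Y_-)X_++[X_-,Y_-]_-$. The Born structure associated with the data $(\mathfrak{g}_\pm,h_\pm,Q,\varphi)$, where $Q\colon(\mathfrak{g}_+,h_+)\to(\mathfrak{g}_-,h_-)$ is a linear isometry, is the one on $\mathfrak{g}_+\rtimes_\varphi\mathfrak{g}_-$ encoded by $(h,J,\mathfrak{g}_\pm)$ with $h=h_+\oplus h_-$ and $J=\begin{pmatrix}0&-Q^{-1}\\Q&0\end{pmatrix}$ in the splitting $\mathfrak{g}_+\oplus\mathfrak{g}_-$. *)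

theory Defs
  imports "HOL-Analysis.Analysis"
begin

text \<open>
  The underlying vector space of a Lie algebra is a whole type of class \<open>real_vector\<close>, with finite
  dimension as an explicit condition; unlike \<open>euclidean_space\<close>, this singles out no inner product
  and allows dimension zero.
\<close>

definition fin_dim :: "'a::real_vector itself \<Rightarrow> bool" where
  "fin_dim _ \<longleftrightarrow> (\<exists>B :: 'a set. finite B \<and> span B = UNIV)"

definition lie_algebra :: "('a::real_vector \<Rightarrow> 'a \<Rightarrow> 'a) \<Rightarrow> bool" where
  "lie_algebra br \<longleftrightarrow>
     fin_dim TYPE('a) \<and> bilinear br \<and> (\<forall>x. br x x = 0) \<and>
     (\<forall>x y z. br x (br y z) + br y (br z x) + br z (br x y) = 0)"

definition abelian_bracket :: "'a::real_vector \<Rightarrow> 'a \<Rightarrow> 'a" where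
  "abelian_bracket x y = 0"

definition lie_subalgebra :: "('a::real_vector \<Rightarrow> 'a \<Rightarrow> 'a) \<Rightarrow> 'a set \<Rightarrow> bool" where
  "lie_subalgebra br S \<longleftrightarrow> subspace S \<and> (\<forall>x\<in>S. \<forall>y\<in>S. br x y \<in> S)"

definition lie_derivation :: "('a::real_vector \<Rightarrow> 'a \<Rightarrow> 'a) \<Rightarrow> ('a \<Rightarrow> 'a) \<Rightarrow> bool" where
  "lie_derivation br D \<longleftrightarrow> linear D \<and> (\<forall>x y. D (br x y) = br (D x) y + br x (D y))"

definition derivation_representation ::
  "('m::real_vector \<Rightarrow> 'm \<Rightarrow> 'm) \<Rightarrow> ('p::real_vector \<Rightarrow> 'p \<Rightarrow> 'p) \<Rightarrow> ('m \<Rightarrow> 'p \<Rightarrow> 'p) \<Rightarrow> bool" where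
  "derivation_representation brm brp \<phi> \<longleftrightarrow>
     (\<forall>x. lie_derivation brp (\<phi> x)) \<and> (\<forall>v. linear (\<lambda>x. \<phi> x v)) \<and>
     (\<forall>x y v. \<phi> (brm x y) v = \<phi> x (\<phi> y v) - \<phi> y (\<phi> x v))"

definition semidirect_bracket ::
  "('p::real_vector \<Rightarrow> 'p \<Rightarrow> 'p) \<Rightarrow> ('m::real_vector \<Rightarrow> 'm \<Rightarrow> 'm) \<Rightarrow> ('m \<Rightarrow> 'p \<Rightarrow> 'p) \<Rightarrow>
   'p \<times> 'm \<Rightarrow> 'p \<times> 'm \<Rightarrow> 'p \<times> 'm" where
  "semidirect_bracket brp brm \<phi> X Y =
     (brp (fst X) (fst Y) + \<phi> (snd X) (fst Y) - \<phi> (snd Y) (fst X), brm (snd X) (snd Y))"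

definition nondegenerate :: "('a::real_vector \<Rightarrow> 'a \<Rightarrow> real) \<Rightarrow> bool" where
  "nondegenerate b \<longleftrightarrow> (\<forall>x. (\<forall>y. b x y = 0) \<longrightarrow> x = 0)"

definition pseudo_riemannian_metric :: "('a::real_vector \<Rightarrow> 'a \<Rightarrow> real) \<Rightarrow> bool" where
  "pseudo_riemannian_metric h \<longleftrightarrow> bilinear h \<and> (\<forall>x y. h x y = h y x) \<and> nondegenerate h"

definition two_form :: "('a::real_vector \<Rightarrow> 'a \<Rightarrow> real) \<Rightarrow> bool" where
  "two_form w \<longleftrightarrow> bilinear w \<and> (\<forall>x. w x x = 0)"

text \<open>The Koszul formula for left-invariant vector fields, on which the metric is constant.\<close>

definition levi_civita ::
  "('a::real_vector \<Rightarrow> 'a \<Rightarrow> 'a) \<Rightarrow> ('a \<Rightarrow> 'a \<Rightarrow> real) \<Rightarrow> 'a \<Rightarrow> 'a \<Rightarrow> 'a" where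
  "levi_civita br h x y =
     (THE v. \<forall>z. 2 * h v z = h (br x y) z - h (br y z) x + h (br z x) y)"

definition curvature ::
  "('a::real_vector \<Rightarrow> 'a \<Rightarrow> 'a) \<Rightarrow> ('a \<Rightarrow> 'a \<Rightarrow> 'a) \<Rightarrow> 'a \<Rightarrow> 'a \<Rightarrow> 'a \<Rightarrow> 'a" where
  "curvature br nabla x y z =
     nabla x (nabla y z) - nabla y (nabla x z) - nabla (br x y) z"

definition flat_metric :: "('a::real_vector \<Rightarrow> 'a \<Rightarrow> 'a) \<Rightarrow> ('a \<Rightarrow> 'a \<Rightarrow> real) \<Rightarrow> bool" where
  "flat_metric br h \<longleftrightarrow>
     pseudo_riemannian_metric h \<and> (\<forall>x y z. curvature br (levi_civita br h) x y z = 0)"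

text \<open>Meaningful for non-degenerate \<open>a\<close> and \<open>b\<close> on a finite-dimensional space.\<close>

definition recursion_op ::
  "('a::real_vector \<Rightarrow> 'a \<Rightarrow> real) \<Rightarrow> ('a \<Rightarrow> 'a \<Rightarrow> real) \<Rightarrow> 'a \<Rightarrow> 'a" where
  "recursion_op a b = (THE A. linear A \<and> bij A \<and> (\<forall>x y. a (A x) y = b x y))"

text \<open>The recursion operator from \<open>\<omega>\<close> to \<open>h\<close> is \<open>- J\<close>, hence the sign.\<close>

definition born_J ::
  "('a::real_vector \<Rightarrow> 'a \<Rightarrow> real) \<Rightarrow> ('a \<Rightarrow> 'a \<Rightarrow> real) \<Rightarrow> 'a \<Rightarrow> 'a" where
  "born_J h \<omega> x = - recursion_op \<omega> h x"

definition born_structure ::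
  "('a::real_vector \<Rightarrow> 'a \<Rightarrow> real) \<times> ('a \<Rightarrow> 'a \<Rightarrow> real) \<times> ('a \<Rightarrow> 'a \<Rightarrow> real) \<Rightarrow> bool" where
  "born_structure = (\<lambda>(g, h, \<omega>).
     pseudo_riemannian_metric g \<and> pseudo_riemannian_metric h \<and>
     two_form \<omega> \<and> nondegenerate \<omega> \<and>
     (\<forall>x. recursion_op g \<omega> (recursion_op g \<omega> x) = x) \<and>
     (\<forall>x. recursion_op g h (recursion_op g h x) = x) \<and>
     (\<forall>x. born_J h \<omega> (born_J h \<omega> x) = - x))"

definition ce_diff2 ::
  "('a::real_vector \<Rightarrow> 'a \<Rightarrow> 'a) \<Rightarrow> ('a \<Rightarrow> 'a \<Rightarrow> real) \<Rightarrow> 'a \<Rightarrow> 'a \<Rightarrow> 'a \<Rightarrow> real" where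
  "ce_diff2 br w x y z = - w (br x y) z + w (br x z) y - w (br y z) x"

definition nijenhuis ::
  "('a::real_vector \<Rightarrow> 'a \<Rightarrow> 'a) \<Rightarrow> ('a \<Rightarrow> 'a) \<Rightarrow> 'a \<Rightarrow> 'a \<Rightarrow> 'a" where
  "nijenhuis br J x y = br (J x) (J y) - J (br (J x) y) - J (br x (J y)) + J (J (br x y))"

definition integrable_born ::
  "('a::real_vector \<Rightarrow> 'a \<Rightarrow> 'a) \<Rightarrow>
   ('a \<Rightarrow> 'a \<Rightarrow> real) \<times> ('a \<Rightarrow> 'a \<Rightarrow> real) \<times> ('a \<Rightarrow> 'a \<Rightarrow> real) \<Rightarrow> bool" where
  "integrable_born br = (\<lambda>(g, h, \<omega>).
     (\<forall>x y z. ce_diff2 br \<omega> x y z = 0) \<and>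
     (\<forall>x y. nijenhuis br (born_J h \<omega>) x y = 0) \<and>
     lie_subalgebra br {x. recursion_op g \<omega> x = x} \<and>
     lie_subalgebra br {x. recursion_op g \<omega> x = - x})"

text \<open>
  The Born structure encoded by \<open>h\<close>, \<open>J\<close> and the splitting whose summands are the
  eigenspaces of the involution \<open>A\<close>: \<open>\<omega> = h(J\<cdot>,\<cdot>)\<close> and \<open>g = \<omega>(A\<cdot>,\<cdot>)\<close>.
\<close>

definition encoded_born ::
  "('a::real_vector \<Rightarrow> 'a \<Rightarrow> real) \<Rightarrow> ('a \<Rightarrow> 'a) \<Rightarrow> ('a \<Rightarrow> 'a) \<Rightarrow>
   ('a \<Rightarrow> 'a \<Rightarrow> real) \<times> ('a \<Rightarrow> 'a \<Rightarrow> real) \<times> ('a \<Rightarrow> 'a \<Rightarrow> real)" where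
  "encoded_born h J A = (\<lambda>x y. h (J (A x)) y, h, \<lambda>x y. h (J x) y)"

definition sum_form ::
  "('p \<Rightarrow> 'p \<Rightarrow> real) \<Rightarrow> ('m \<Rightarrow> 'm \<Rightarrow> real) \<Rightarrow> 'p \<times> 'm \<Rightarrow> 'p \<times> 'm \<Rightarrow> real" where
  "sum_form hp hm X Y = hp (fst X) (fst Y) + hm (snd X) (snd Y)"

definition pullback_form :: "('p \<Rightarrow> 'm) \<Rightarrow> ('m \<Rightarrow> 'm \<Rightarrow> real) \<Rightarrow> 'p \<Rightarrow> 'p \<Rightarrow> real" where
  "pullback_form Q h x y = h (Q x) (Q y)"

definition split_J :: "('p::real_vector \<Rightarrow> 'm::real_vector) \<Rightarrow> 'p \<times> 'm \<Rightarrow> 'p \<times> 'm" where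
  "split_J Q X = (- inv Q (snd X), Q (fst X))"

definition split_A :: "'p::real_vector \<times> 'm::real_vector \<Rightarrow> 'p \<times> 'm" where
  "split_A X = (fst X, - snd X)"

definition born_data ::
  "('p::real_vector \<Rightarrow> 'p \<Rightarrow> 'p) \<Rightarrow> ('m::real_vector \<Rightarrow> 'm \<Rightarrow> 'm) \<Rightarrow>
   ('p \<Rightarrow> 'p \<Rightarrow> real) \<Rightarrow> ('m \<Rightarrow> 'm \<Rightarrow> real) \<Rightarrow> ('p \<Rightarrow> 'm) \<Rightarrow> ('m \<Rightarrow> 'p \<Rightarrow> 'p) \<Rightarrow> bool" where
  "born_data brp brm hp hm Q \<phi> \<longleftrightarrow>
     lie_algebra brp \<and> lie_algebra brm \<and>
     pseudo_riemannian_metric hp \<and> pseudo_riemannian_metric hm \<and>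
     linear Q \<and> bij Q \<and> (\<forall>x y. hm (Q x) (Q y) = hp x y) \<and>
     derivation_representation brm brp \<phi>"

definition associated_born ::
  "('p::real_vector \<Rightarrow> 'p \<Rightarrow> real) \<Rightarrow> ('m::real_vector \<Rightarrow> 'm \<Rightarrow> real) \<Rightarrow> ('p \<Rightarrow> 'm) \<Rightarrow>
   ('p \<times> 'm \<Rightarrow> 'p \<times> 'm \<Rightarrow> real) \<times> ('p \<times> 'm \<Rightarrow> 'p \<times> 'm \<Rightarrow> real) \<times> ('p \<times> 'm \<Rightarrow> 'p \<times> 'm \<Rightarrow> real)" where
  "associated_born hp hm Q = encoded_born (sum_form hp hm) (split_J Q) split_A"

end

theory Submission
  imports Defs
begin

text \<open>
  The key is to find the Levi-Civita connection of \<open>h\<close>.  Let \<open>\<nabla>\<close> be the Levi-Civita connection of \<open>h\<^sub>-\<close>, and let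
  \<open>X = X\<^sub>+ + X\<^sub>-\<close> differentiate \<open>Y = Y\<^sub>+ + Y\<^sub>-\<close> by the flat connection of its second component only,
  transported to the first summand by \<open>Q\<close>:
  \<open>D X Y = Q\<^sup>-\<^sup>1 \<nabla>\<^bsub>X\<^sub>-\<^esub> (Q Y\<^sub>+) + \<nabla>\<^bsub>X\<^sub>-\<^esub> Y\<^sub>-\<close>.
  Because the first summand is abelian, \<open>D\<close> is torsion-free for the bracket of the semidirect product,
  and because \<open>\<nabla>\<close> is metric and \<open>Q\<close> is an isometry, \<open>D\<close> is metric for \<open>h = h\<^sub>+ \<oplus> h\<^sub>-\<close>.  So \<open>D\<close> is
  the Levi-Civita connection of \<open>h\<close>.  It acts on each summand by a copy of \<open>\<nabla>\<close>, so it is flat; and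
  \<open>J\<close> only exchanges these two copies, so \<open>J\<close> is parallel.

  A torsion-free connection for which \<open>J\<close> is parallel makes the Nijenhuis tensor of \<open>J\<close> vanish, and if
  it is also metric, it makes \<open>\<omega> = h(J\<cdot>,\<cdot>)\<close> parallel and hence closed.  The eigenspaces of \<open>A\<close> are
  the two factors of the semidirect product, which are subalgebras.  That \<open>\<phi>\<close> is a representation is
  precisely the flatness of \<open>\<nabla>\<close>.  The remaining algebraic axioms of a Born structure say nothing
  about brackets: they hold because \<open>A\<close> and \<open>J\<close> are anticommuting isometries of \<open>h\<close> with
  \<open>A\<^sup>2 = 1\<close> and \<open>J\<^sup>2 = -1\<close>.

  Two facts on forms support this: a non-degenerate form on a finite-dimensional space represents
  every functional, so that the Koszul formula defines a connection at all; and a non-degenerate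
  form determines vectors, so that Levi-Civita connections and recursion operators can be recognised
  from their defining equations.
\<close>

section \<open>Non-degenerate bilinear forms\<close>

lemma bilinearI:
  assumes "\<And>x. linear (f x)" "\<And>y. linear (\<lambda>x. f x y)"
  shows "bilinear f"
  using assms by (simp add: bilinear_def)

lemma bilinear_linear_left: "bilinear f \<Longrightarrow> linear (\<lambda>x. f x y)"
  and bilinear_linear_right: "bilinear f \<Longrightarrow> linear (f x)"
  by (simp_all add: bilinear_def)

lemma nondegenerate_eqI:
  assumes "bilinear b" "nondegenerate b" "\<And>z. b v z = b w z"
  shows "v = w"
proof -
  have "b (v - w) z = 0" for z
    using assms(3) by (simp add: bilinear_lsub[OF assms(1)])
  then have "v - w = 0" using assms(2) unfolding nondegenerate_def by blast
  then show ?thesis by simp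
qed

text \<open>
  The values of \<open>b v\<close> on a basis, used as coordinates in that same basis, give an endomorphism
  \<open>v \<mapsto> T v\<close>.  Non-degeneracy makes it injective, and finite dimension then makes it surjective.
\<close>

lemma nondegenerate_represents_functional:
  fixes b :: "'a::real_vector \<Rightarrow> 'a \<Rightarrow> real"
  assumes fd: "fin_dim TYPE('a)" and bil: "bilinear b" and nd: "nondegenerate b" and f: "linear f"
  shows "\<exists>v. \<forall>z. b v z = f z"
proof -
  obtain B0 :: "'a set" where B0: "finite B0" "span B0 = UNIV"
    using fd by (auto simp: fin_dim_def)
  obtain B where B: "B \<subseteq> B0" "independent B" "B0 \<subseteq> span B"
    using maximal_independent_subset by blast
  have fin: "finite B" using B(1) B0(1) finite_subset by blast
  have sp: "span B = UNIV"
    using B(3) B0(2) by (metis span_mono span_span top.extremum_uniqueI)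
  interpret fd: finite_dimensional_vector_space "scaleR :: real \<Rightarrow> 'a \<Rightarrow> 'a" B
    by unfold_locales
      (use fin sp B(2) in \<open>auto simp: dependent_raw_def span_raw_def\<close>)
  define T where "T v = (\<Sum>c\<in>B. b v c *\<^sub>R c)" for v
  have linT: "linear T"
    unfolding T_def
    by (rule linearI)
      (simp_all add: linear_add[OF bilinear_linear_left[OF bil]]
        linear_scale[OF bilinear_linear_left[OF bil]] scaleR_add_left sum.distrib scaleR_sum_right)
  have coords: "\<forall>c\<in>B. u c = w c"
    if "(\<Sum>c\<in>B. u c *\<^sub>R c) = (\<Sum>c\<in>B. w c *\<^sub>R c)" for u w :: "'a \<Rightarrow> real"
  proof
    fix c assume "c \<in> B"
    moreover have "(\<Sum>c\<in>B. (u c - w c) *\<^sub>R c) = 0"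
      using that by (simp add: scaleR_diff_left sum_subtractf)
    ultimately show "u c = w c"
      using B(2) fin independentD[of B B "\<lambda>c. u c - w c" c] by auto
  qed
  have on_basis: "v = w" if "\<And>c. c \<in> B \<Longrightarrow> b v c = b w c" for v w
  proof (rule nondegenerate_eqI[OF bil nd])
    show "b v z = b w z" for z
      by (rule linear_eq_on[of "b v" "b w" z B])
        (use that sp in \<open>auto intro: bilinear_linear_right[OF bil]\<close>)
  qed
  have "inj T"
    by (rule injI, rule on_basis) (use coords in \<open>auto simp: T_def\<close>)
  then have "surj T"
    using linT fd.linear_inj_imp_surj unfolding linear_def by blast
  then obtain v where "T v = (\<Sum>c\<in>B. f c *\<^sub>R c)" by (metis surjD)
  then have "\<forall>c\<in>B. b v c = f c" using coords by (auto simp: T_def)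
  then have "b v z = f z" for z
    by (intro linear_eq_on[of "b v" f z B]) (use sp f in \<open>auto intro: bilinear_linear_right[OF bil]\<close>)
  then show ?thesis by blast
qed

section \<open>Torsion-free connections\<close>

definition torsion_free :: "('a::real_vector \<Rightarrow> 'a \<Rightarrow> 'a) \<Rightarrow> ('a \<Rightarrow> 'a \<Rightarrow> 'a) \<Rightarrow> bool" where
  "torsion_free br D \<longleftrightarrow> (\<forall>x y. D x y - D y x = br x y)"

text \<open>Metrics are constant on left-invariant vector fields, so no derivative of \<open>h\<close> occurs.\<close>

definition metric_connection :: "('a::real_vector \<Rightarrow> 'a \<Rightarrow> real) \<Rightarrow> ('a \<Rightarrow> 'a \<Rightarrow> 'a) \<Rightarrow> bool" where
  "metric_connection h D \<longleftrightarrow> (\<forall>x y z. h (D x y) z + h y (D x z) = 0)"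

lemma lie_bracket_skew:
  assumes "lie_algebra br"
  shows "br y x = - br x y"
proof -
  have bil: "bilinear br" and alt: "br z z = 0" for z using assms by (auto simp: lie_algebra_def)
  have "br (x + y) (x + y) = br x x + br x y + br y x + br y y"
    by (simp add: bilinear_ladd[OF bil] bilinear_radd[OF bil])
  then show ?thesis by (simp add: alt add_eq_0_iff)
qed

lemma levi_civita_eqI:
  assumes "pseudo_riemannian_metric h"
    and "\<And>z. 2 * h v z = h (br x y) z - h (br y z) x + h (br z x) y"
  shows "levi_civita br h x y = v"
  unfolding levi_civita_def
proof (rule the_equality)
  fix w assume w: "\<forall>z. 2 * h w z = h (br x y) z - h (br y z) x + h (br z x) y"
  have "h w z = h v z" for z
    using w[rule_format, of z] assms(2)[of z] by linarith
  then show "w = v"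
    using assms(1) nondegenerate_eqI[of h] by (auto simp: pseudo_riemannian_metric_def)
qed (use assms(2) in blast)

text \<open>
  Writing brackets as \<open>D x y - D y x\<close> turns the right-hand side of the Koszul formula into six terms
  of the form \<open>h (D u v) w\<close>, of which skewness in \<open>v, w\<close> cancels four and identifies the other two.
\<close>

lemma levi_civita_unique:
  assumes h: "pseudo_riemannian_metric h"
    and tf: "torsion_free br D" and mc: "metric_connection h D"
  shows "levi_civita br h = D"
proof (intro ext levi_civita_eqI[OF h])
  fix x y z
  have br: "br u v = D u v - D v u" for u v using tf by (simp add: torsion_free_def)
  have sym: "h u v = h v u" and bil: "bilinear h" for u v
    using h by (auto simp: pseudo_riemannian_metric_def)
  have skew: "h (D u w) v = - h (D u v) w" for u v w
    using mc by (metis metric_connection_def add_eq_0_iff2 sym)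
  show "2 * h (D x y) z = h (br x y) z - h (br y z) x + h (br z x) y"
    using skew[of x y z] skew[of z x y] skew[of y x z] by (simp add: br bilinear_lsub[OF bil])
qed

text \<open>The right-hand side is linear in \<open>z\<close>, hence represented by some vector; this is the existence
  part that the definite description in the definition leaves open.\<close>

lemma levi_civita_koszul:
  fixes h :: "'a::real_vector \<Rightarrow> 'a \<Rightarrow> real"
  assumes la: "lie_algebra br" and h: "pseudo_riemannian_metric h"
  shows "2 * h (levi_civita br h x y) z = h (br x y) z - h (br y z) x + h (br z x) y"
proof -
  have fd: "fin_dim TYPE('a)" and bb: "bilinear br" using la by (auto simp: lie_algebra_def)
  have bil: "bilinear h" and nd: "nondegenerate h"
    using h by (auto simp: pseudo_riemannian_metric_def)
  let ?f = "\<lambda>z. (h (br x y) z - h (br y z) x + h (br z x) y) / 2"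
  have "linear ?f"
    by (rule linearI)
      (simp_all add: bilinear_ladd[OF bil] bilinear_radd[OF bil] bilinear_ladd[OF bb]
        bilinear_radd[OF bb] bilinear_lmul[OF bil] bilinear_rmul[OF bil] bilinear_lmul[OF bb]
        bilinear_rmul[OF bb] field_simps)
  then obtain v where "\<forall>z. h v z = ?f z"
    using nondegenerate_represents_functional[OF fd bil nd] by blast
  then have v: "2 * h v z = h (br x y) z - h (br y z) x + h (br z x) y" for z
    by (metis nonzero_eq_divide_eq mult.commute zero_neq_numeral)
  with levi_civita_eqI[OF h v] show ?thesis by simp
qed

lemma levi_civita_bilinear:
  assumes la: "lie_algebra br" and h: "pseudo_riemannian_metric h"
  shows "bilinear (levi_civita br h)"
proof -
  have bb: "bilinear br" using la by (auto simp: lie_algebra_def)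
  have bil: "bilinear h" using h by (auto simp: pseudo_riemannian_metric_def)
  note K = levi_civita_koszul[OF la h]
  note S = bilinear_ladd[OF bil] bilinear_radd[OF bil] bilinear_ladd[OF bb] bilinear_radd[OF bb]
    bilinear_lmul[OF bil] bilinear_rmul[OF bil] bilinear_lmul[OF bb] bilinear_rmul[OF bb]
  show ?thesis
  proof (intro bilinearI linearI)
    show "levi_civita br h x (y + z) = levi_civita br h x y + levi_civita br h x z" for x y z
      by (rule levi_civita_eqI[OF h]) (simp add: S K distrib_left)
    show "levi_civita br h x (c *\<^sub>R y) = c *\<^sub>R levi_civita br h x y" for x y c
      by (rule levi_civita_eqI[OF h]) (simp add: S K mult.left_commute[of 2] algebra_simps)
    show "levi_civita br h (x + y) z = levi_civita br h x z + levi_civita br h y z" for x y z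
      by (rule levi_civita_eqI[OF h]) (simp add: S K distrib_left)
    show "levi_civita br h (c *\<^sub>R x) y = c *\<^sub>R levi_civita br h x y" for x y c
      by (rule levi_civita_eqI[OF h]) (simp add: S K mult.left_commute[of 2] algebra_simps)
  qed
qed

lemma levi_civita_torsion_free:
  assumes la: "lie_algebra br" and h: "pseudo_riemannian_metric h"
  shows "torsion_free br (levi_civita br h)"
  unfolding torsion_free_def
proof (intro allI)
  fix x y
  have bil: "bilinear h" and nd: "nondegenerate h"
    using h by (auto simp: pseudo_riemannian_metric_def)
  have "2 * h (levi_civita br h x y - levi_civita br h y x) z = 2 * h (br x y) z" for z
    using lie_bracket_skew[OF la, of z x] lie_bracket_skew[OF la, of z y]
      lie_bracket_skew[OF la, of y x]
    by (simp add: bilinear_lsub[OF bil] bilinear_lneg[OF bil] right_diff_distrib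
        levi_civita_koszul[OF la h])
  then show "levi_civita br h x y - levi_civita br h y x = br x y"
    by (intro nondegenerate_eqI[OF bil nd]) simp
qed

lemma levi_civita_metric:
  assumes la: "lie_algebra br" and h: "pseudo_riemannian_metric h"
  shows "metric_connection h (levi_civita br h)"
  unfolding metric_connection_def
proof (intro allI)
  fix x y z
  have bil: "bilinear h" and sym: "h u v = h v u" for u v
    using h by (auto simp: pseudo_riemannian_metric_def)
  have "2 * h (levi_civita br h x y) z + 2 * h (levi_civita br h x z) y = 0"
    unfolding levi_civita_koszul[OF la h]
    using lie_bracket_skew[OF la, of z x] lie_bracket_skew[OF la, of z y]
      lie_bracket_skew[OF la, of y x]
    by (simp add: bilinear_lneg[OF bil])
  then show "h (levi_civita br h x y) z + h y (levi_civita br h x z) = 0"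
    using sym[of y "levi_civita br h x z"] by simp
qed

text \<open>With brackets expressed by \<open>D\<close> and \<open>J\<close> moved out of \<open>D\<close>, the eight terms cancel in pairs.\<close>

lemma nijenhuis_parallel:
  assumes "torsion_free br D" "linear J" "\<And>x y. D x (J y) = J (D x y)"
  shows "nijenhuis br J x y = 0"
proof -
  have br: "br u v = D u v - D v u" for u v using assms(1) by (simp add: torsion_free_def)
  show ?thesis
    by (simp add: nijenhuis_def br assms(3) linear_diff[OF assms(2)])
qed

text \<open>For a torsion-free connection the differential is the alternation of the covariant derivative.\<close>

lemma ce_diff2_parallel:
  assumes "torsion_free br D" "two_form w" "\<And>x y z. w (D x y) z + w y (D x z) = 0"
  shows "ce_diff2 br w x y z = 0"
proof -
  have br: "br u v = D u v - D v u" for u v using assms(1) by (simp add: torsion_free_def)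
  have bil: "bilinear w" and alt: "w u u = 0" for u using assms(2) by (auto simp: two_form_def)
  have skew: "w u v = - w v u" for u v
  proof -
    have "w (u + v) (u + v) = w u u + w u v + w v u + w v v"
      by (simp add: bilinear_ladd[OF bil] bilinear_radd[OF bil])
    then show ?thesis by (simp add: alt)
  qed
  show ?thesis
    using assms(3)[of x y z] assms(3)[of y x z] assms(3)[of z x y]
      skew[of y "D x z"] skew[of x "D y z"] skew[of x "D z y"]
    by (simp add: ce_diff2_def br bilinear_lsub[OF bil])
qed

section \<open>Born structures encoded by a pair of anticommuting operators\<close>

lemma recursion_op_eqI:
  assumes "bilinear a" "nondegenerate a" "linear A" "bij A" "\<And>x y. a (A x) y = b x y"
  shows "recursion_op a b = A"
  unfolding recursion_op_def
proof (rule the_equality)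
  show "A' = A" if "linear A' \<and> bij A' \<and> (\<forall>x y. a (A' x) y = b x y)" for A'
    by (intro ext nondegenerate_eqI[OF assms(1,2)]) (use that assms(5) in auto)
qed (use assms in blast)

lemma nondegenerate_compose:
  assumes "nondegenerate h" "linear T" "inj T"
  shows "nondegenerate (\<lambda>x y. h (T x) y)"
  unfolding nondegenerate_def
proof (intro allI impI)
  fix x assume "\<forall>y. h (T x) y = 0"
  then have "T x = T 0" using assms(1) by (simp add: nondegenerate_def linear_0[OF assms(2)])
  then show "x = 0" using assms(3) by (simp add: inj_eq)
qed

lemma bilinear_compose:
  assumes "bilinear h" "linear T"
  shows "bilinear (\<lambda>x y. h (T x) y)"
  by (rule bilinearI)
    (use assms linear_compose[OF assms(2) bilinear_linear_left[OF assms(1)]]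
      in \<open>auto simp: o_def intro: bilinear_linear_right\<close>)

text \<open>
  The splitting is recorded by the involution \<open>A\<close> whose eigenspaces are its summands: they are
  orthogonal exactly if \<open>A\<close> is an isometry, and interchanged by \<open>J\<close> exactly if \<open>A\<close> and \<open>J\<close>
  anticommute.  The recursion operators of the encoded triple are then \<open>A\<close>, \<open>J A\<close> and \<open>- J\<close>.
\<close>

locale born_operators =
  fixes h :: "'a::real_vector \<Rightarrow> 'a \<Rightarrow> real" and J A :: "'a \<Rightarrow> 'a"
  assumes metric: "pseudo_riemannian_metric h"
    and linear_J: "linear J" and linear_A: "linear A"
    and J_J: "J (J x) = - x" and A_A: "A (A x) = x"
    and A_J: "A (J x) = - J (A x)"
    and h_J_J: "h (J x) (J y) = h x y" and h_A_A: "h (A x) (A y) = h x y"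
begin

abbreviation (input) g where "g \<equiv> \<lambda>x y. h (J (A x)) y"
abbreviation (input) \<omega> where "\<omega> \<equiv> \<lambda>x y. h (J x) y"

lemma h_sym: "h x y = h y x"
  and bilinear_h: "bilinear h" and nondegenerate_h: "nondegenerate h"
  using metric by (auto simp: pseudo_riemannian_metric_def)

lemma h_J_skew: "h (J x) y = - h x (J y)"
  using h_J_J[of x "J y"] by (simp add: J_J bilinear_rneg[OF bilinear_h])

lemma h_A_sym: "h (A x) y = h x (A y)"
  using h_A_A[of x "A y"] by (simp add: A_A)

lemma bij_J: "bij J"
  by (rule o_bij[of "\<lambda>x. - J x"]) (auto simp: J_J linear_neg[OF linear_J])

lemma bij_A: "bij A"
  by (rule o_bij[of A]) (auto simp: A_A)

lemma linear_J_A: "linear (\<lambda>x. J (A x))"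
  using linear_compose[OF linear_A linear_J] by (simp add: o_def)

lemma bij_J_A: "bij (\<lambda>x. J (A x))"
  using bij_comp[OF bij_A bij_J] by (simp add: o_def)

lemma J_A_J_A: "J (A (J (A x))) = x"
  by (simp add: A_J A_A J_J linear_neg[OF linear_J])

lemma bilinear_g: "bilinear g" and nondegenerate_g: "nondegenerate g"
  using bilinear_compose[OF bilinear_h linear_J_A] bij_J_A
    nondegenerate_compose[OF nondegenerate_h linear_J_A] by (auto simp: bij_def)

lemma nondegenerate_\<omega>: "nondegenerate \<omega>"
  using nondegenerate_compose[OF nondegenerate_h linear_J] bij_J by (auto simp: bij_def)

lemma two_form_\<omega>: "two_form \<omega>"
  unfolding two_form_def
proof (intro conjI allI)
  show "bilinear \<omega>" by (rule bilinear_compose[OF bilinear_h linear_J])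
  show "h (J x) x = 0" for x using h_J_skew[of x x] h_sym[of "J x" x] by simp
qed

lemma recursion_g_\<omega>: "recursion_op g \<omega> = A"
  by (rule recursion_op_eqI[OF bilinear_g nondegenerate_g linear_A bij_A]) (simp add: A_A)

lemma recursion_g_h: "recursion_op g h = (\<lambda>x. J (A x))"
  by (rule recursion_op_eqI[OF bilinear_g nondegenerate_g linear_J_A bij_J_A]) (simp add: J_A_J_A)

lemma born_J_eq: "born_J h \<omega> = J"
proof -
  have "recursion_op \<omega> h = (\<lambda>x. - J x)"
  proof (rule recursion_op_eqI)
    show "bilinear \<omega>" "nondegenerate \<omega>"
      using two_form_\<omega> nondegenerate_\<omega> by (auto simp: two_form_def)
    show "linear (\<lambda>x. - J x)" using linear_J by (rule linear_compose_neg)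
    show "bij (\<lambda>x. - J x)"
      by (rule o_bij[of J]) (auto simp: J_J linear_neg[OF linear_J])
  qed (simp add: J_J linear_neg[OF linear_J])
  then show ?thesis by (simp add: born_J_def fun_eq_iff)
qed

text \<open>
  The one condition left to the proof is the symmetry of \<open>g = h(J A \<cdot>,\<cdot>)\<close>: the sign from the skewness
  of \<open>J\<close> is absorbed by the anticommutation of \<open>A\<close> and \<open>J\<close>.
\<close>

theorem born_structure_encoded: "born_structure (encoded_born h J A)"
proof -
  have "h (J (A x)) y = h (J (A y)) x" for x y
    using h_J_skew[of "A x" y] h_A_sym[of x "J y"] A_J[of y] h_sym[of x "J (A y)"]
    by (simp add: bilinear_rneg[OF bilinear_h])
  then have "pseudo_riemannian_metric g"
    using bilinear_g nondegenerate_g by (simp add: pseudo_riemannian_metric_def)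
  then show ?thesis
    by (simp add: born_structure_def encoded_born_def metric two_form_\<omega> nondegenerate_\<omega>
        recursion_g_\<omega> recursion_g_h born_J_eq J_A_J_A A_A J_J)
qed

text \<open>
  Any torsion-free metric connection with \<open>J\<close> parallel serves as witness: it makes \<open>\<omega> = h(J\<cdot>,\<cdot>)\<close>
  parallel too, so that closedness and the vanishing of the Nijenhuis tensor follow together.
\<close>

theorem integrable_born_parallel:
  assumes tf: "torsion_free br D" and mc: "metric_connection h D"
    and par: "\<And>x y. D x (J y) = J (D x y)"
    and sub: "lie_subalgebra br {x. A x = x}" "lie_subalgebra br {x. A x = - x}"
  shows "integrable_born br (encoded_born h J A)"
proof -
  have "ce_diff2 br \<omega> x y z = 0" for x y z
  proof (rule ce_diff2_parallel[OF tf two_form_\<omega>])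
    show "h (J (D u v)) w + h (J v) (D u w) = 0" for u v w
      using mc by (simp add: metric_connection_def flip: par)
  qed
  then show ?thesis
    using nijenhuis_parallel[OF tf linear_J par] sub
    by (simp add: integrable_born_def encoded_born_def recursion_g_\<omega> born_J_eq)
qed

end

section \<open>Semidirect products\<close>

lemma fin_dim_prod:
  assumes "fin_dim TYPE('p::real_vector)" "fin_dim TYPE('m::real_vector)"
  shows "fin_dim TYPE('p \<times> 'm)"
proof -
  obtain B :: "'p set" and C :: "'m set"
    where B: "finite B" "span B = UNIV" and C: "finite C" "span C = UNIV"
    using assms by (auto simp: fin_dim_def)
  let ?S = "(\<lambda>x. (x, 0)) ` B \<union> (\<lambda>y. (0, y)) ` C"
  have l1: "linear (\<lambda>x::'p. (x, 0::'m))" and l2: "linear (\<lambda>y::'m. (0::'p, y))"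
    by (auto intro!: linearI)
  have "(x, y) \<in> span ?S" for x y
  proof -
    have "(x, 0) \<in> span ((\<lambda>x. (x, 0::'m)) ` B)" "(0, y) \<in> span ((\<lambda>y. (0::'p, y)) ` C)"
      using B(2) C(2) by (auto simp: linear_span_image[OF l1] linear_span_image[OF l2])
    then have "(x, 0) \<in> span ?S" "(0, y) \<in> span ?S"
      by (meson span_mono subsetD sup_ge1 sup_ge2)+
    then have "(x, 0) + (0, y) \<in> span ?S" by (rule span_add)
    then show ?thesis by simp
  qed
  then have "span ?S = UNIV" by auto
  then show ?thesis using B(1) C(1) unfolding fin_dim_def by (intro exI[of _ ?S]) auto
qed

text \<open>
  In the first component of the Jacobi identity, the derivation property produces mixed terms
  \<open>brp (\<phi> u y) z\<close> that cancel by skewness, and the commutator rule disposes of the terms in which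
  \<open>\<phi>\<close> acts twice.
\<close>

lemma lie_algebra_semidirect:
  assumes p: "lie_algebra brp" and m: "lie_algebra brm"
    and rep: "derivation_representation brm brp \<phi>"
  shows "lie_algebra (semidirect_bracket brp brm \<phi>)"
proof -
  have bp: "bilinear brp" and bm: "bilinear brm" using p m by (auto simp: lie_algebra_def)
  have bphi: "bilinear \<phi>"
    using rep by (auto simp: derivation_representation_def lie_derivation_def bilinear_def)
  have der: "\<phi> x (brp u v) = brp (\<phi> x u) v + brp u (\<phi> x v)" for x u v
    using rep by (auto simp: derivation_representation_def lie_derivation_def)
  have comm: "\<phi> (brm x y) v = \<phi> x (\<phi> y v) - \<phi> y (\<phi> x v)" for x y v
    using rep by (auto simp: derivation_representation_def)
  note S = bilinear_ladd[OF bp] bilinear_radd[OF bp] bilinear_lsub[OF bp] bilinear_rsub[OF bp]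
    bilinear_lmul[OF bp] bilinear_rmul[OF bp]
    bilinear_ladd[OF bm] bilinear_radd[OF bm] bilinear_lmul[OF bm] bilinear_rmul[OF bm]
    bilinear_ladd[OF bphi] bilinear_radd[OF bphi] bilinear_lsub[OF bphi] bilinear_rsub[OF bphi]
    bilinear_lmul[OF bphi] bilinear_rmul[OF bphi]
  have jp: "brp x (brp y z) + brp y (brp z x) + brp z (brp x y) = 0"
    and jm: "brm u (brm v w) + brm v (brm w u) + brm w (brm u v) = 0" for x y z u v w
    using p m by (auto simp: lie_algebra_def)
  show ?thesis
    unfolding lie_algebra_def
  proof (intro conjI allI)
    show "fin_dim TYPE('a \<times> 'b)" using p m by (auto simp: lie_algebra_def intro: fin_dim_prod)
    show "bilinear (semidirect_bracket brp brm \<phi>)"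
      by (intro bilinearI linearI)
        (simp_all add: semidirect_bracket_def prod_eq_iff S scaleR_add_right scaleR_diff_right)
    show "semidirect_bracket brp brm \<phi> X X = 0" for X
      using p m by (simp add: semidirect_bracket_def lie_algebra_def zero_prod_def)
    fix X Y Z :: "'a \<times> 'b"
    obtain x u y v z w where XYZ: "X = (x, u)" "Y = (y, v)" "Z = (z, w)"
      by (metis surj_pair)
    show "semidirect_bracket brp brm \<phi> X (semidirect_bracket brp brm \<phi> Y Z)
        + semidirect_bracket brp brm \<phi> Y (semidirect_bracket brp brm \<phi> Z X)
        + semidirect_bracket brp brm \<phi> Z (semidirect_bracket brp brm \<phi> X Y) = 0"
      using jp[of x y z] jm[of u v w]
        lie_bracket_skew[OF p, of "\<phi> u y" z] lie_bracket_skew[OF p, of "\<phi> v z" x]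
        lie_bracket_skew[OF p, of "\<phi> w x" y]
      by (simp add: XYZ semidirect_bracket_def zero_prod_def S der comm algebra_simps)
  qed
qed

lemma lie_subalgebra_split_A:
  assumes "lie_algebra brp" "lie_algebra brm" "derivation_representation brm brp \<phi>"
  shows "lie_subalgebra (semidirect_bracket brp brm \<phi>) {X. split_A X = X}"
    and "lie_subalgebra (semidirect_bracket brp brm \<phi>) {X. split_A X = - X}"
proof -
  have bp: "bilinear brp" and bm: "bilinear brm" using assms by (auto simp: lie_algebra_def)
  have bphi: "bilinear \<phi>"
    using assms(3) by (auto simp: derivation_representation_def lie_derivation_def bilinear_def)
  have neg: "- x = x \<longleftrightarrow> x = 0" "x = - x \<longleftrightarrow> x = 0" for x :: "'c::real_vector"
  proof -
    have "x = 0" if "x = - x" using that scaleR_2[of x] by (metis add_eq_0_iff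
          scaleR_eq_0_iff zero_neq_numeral)
    then show "- x = x \<longleftrightarrow> x = 0" "x = - x \<longleftrightarrow> x = 0" by (metis neg_0_equal_iff_equal)+
  qed
  then have plus: "{X. split_A X = X} = {X :: 'a \<times> 'b. snd X = 0}"
    and minus: "{X. split_A X = - X} = {X :: 'a \<times> 'b. fst X = 0}"
    by (simp_all add: split_A_def prod_eq_iff neg)
  show "lie_subalgebra (semidirect_bracket brp brm \<phi>) {X. split_A X = X}"
    unfolding plus
    by (auto simp: lie_subalgebra_def subspace_def semidirect_bracket_def bilinear_lzero[OF bm])
  show "lie_subalgebra (semidirect_bracket brp brm \<phi>) {X. split_A X = - X}"
    unfolding minus
    by (auto simp: lie_subalgebra_def subspace_def semidirect_bracket_def bilinear_lzero[OF bp]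
        bilinear_rzero[OF bphi])
qed

lemma sum_form_metric:
  assumes "pseudo_riemannian_metric hp" "pseudo_riemannian_metric hm"
  shows "pseudo_riemannian_metric (sum_form hp hm)"
proof -
  have bp: "bilinear hp" and bm: "bilinear hm"
    using assms by (auto simp: pseudo_riemannian_metric_def)
  note S = bilinear_ladd[OF bp] bilinear_radd[OF bp] bilinear_lmul[OF bp] bilinear_rmul[OF bp]
    bilinear_ladd[OF bm] bilinear_radd[OF bm] bilinear_lmul[OF bm] bilinear_rmul[OF bm]
  show ?thesis
    unfolding pseudo_riemannian_metric_def
  proof (intro conjI allI)
    show "bilinear (sum_form hp hm)"
      by (intro bilinearI linearI) (simp_all add: sum_form_def S distrib_left)
    show "sum_form hp hm X Y = sum_form hp hm Y X" for X Y
      using assms by (simp add: pseudo_riemannian_metric_def sum_form_def)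
    show "nondegenerate (sum_form hp hm)"
      unfolding nondegenerate_def
    proof (intro allI impI)
      fix X assume X: "\<forall>Y. sum_form hp hm X Y = 0"
      have "hp (fst X) y = 0" for y
        using X[rule_format, of "(y, 0)"] by (simp add: sum_form_def bilinear_rzero[OF bm])
      moreover have "hm (snd X) y = 0" for y
        using X[rule_format, of "(0, y)"] by (simp add: sum_form_def bilinear_rzero[OF bp])
      ultimately show "X = 0"
        using assms by (auto simp: pseudo_riemannian_metric_def nondegenerate_def prod_eq_iff)
    qed
  qed
qed

lemma pullback_form_metric:
  assumes "pseudo_riemannian_metric h" "linear Q" "bij Q"
  shows "pseudo_riemannian_metric (pullback_form Q h)"
proof -
  have b: "bilinear h" using assms(1) by (auto simp: pseudo_riemannian_metric_def)
  have "bilinear (pullback_form Q h)"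
    by (intro bilinearI linearI)
      (simp_all add: pullback_form_def linear_add[OF assms(2)] linear_scale[OF assms(2)]
        bilinear_ladd[OF b] bilinear_radd[OF b] bilinear_lmul[OF b] bilinear_rmul[OF b])
  moreover have "nondegenerate (pullback_form Q h)"
    unfolding nondegenerate_def
  proof (intro allI impI)
    fix x assume x: "\<forall>y. pullback_form Q h x y = 0"
    have "h (Q x) z = 0" for z
      using x[rule_format, of "inv Q z"] assms(3)
      by (simp add: pullback_form_def bij_def surj_f_inv_f)
    then have "Q x = Q 0"
      using assms(1) by (simp add: pseudo_riemannian_metric_def nondegenerate_def
          linear_0[OF assms(2)])
    then show "x = 0" using assms(3) by (simp add: bij_def inj_eq)
  qed
  ultimately show ?thesis
    using assms(1) by (simp add: pseudo_riemannian_metric_def pullback_form_def)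
qed

lemma linear_inv_bij:
  assumes "linear Q" "bij Q"
  shows "linear (inv Q)"
proof (rule linearI)
  have QQ: "Q (inv Q z) = z" for z using assms(2) by (simp add: bij_is_surj surj_f_inv_f)
  have inj: "x = y" if "Q x = Q y" for x y using assms(2) that by (simp add: bij_is_inj inj_eq)
  show "inv Q (x + y) = inv Q x + inv Q y" for x y
    by (rule inj) (simp add: QQ linear_add[OF assms(1)])
  show "inv Q (c *\<^sub>R x) = c *\<^sub>R inv Q x" for c x
    by (rule inj) (simp add: QQ linear_scale[OF assms(1)])
qed

lemma born_operators_split:
  assumes hp: "pseudo_riemannian_metric hp" and hm: "pseudo_riemannian_metric hm"
    and Q: "linear Q" "bij Q" and iso: "\<And>x y. hm (Q x) (Q y) = hp x y"
  shows "born_operators (sum_form hp hm) (split_J Q) split_A"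
  unfolding born_operators_def
proof (intro conjI allI)
  have inv: "linear (inv Q)"
    using Q by (rule linear_inv_bij)
  have QQ: "Q (inv Q z) = z" "inv Q (Q x) = x" for x z
    using Q(2) by (simp_all add: bij_is_surj surj_f_inv_f bij_is_inj)
  have bp: "bilinear hp" and bm: "bilinear hm"
    using hp hm by (auto simp: pseudo_riemannian_metric_def)
  show "pseudo_riemannian_metric (sum_form hp hm)" by (rule sum_form_metric[OF hp hm])
  show "linear (split_J Q)"
    by (rule linearI) (simp_all add: split_J_def prod_eq_iff linear_add[OF inv]
        linear_add[OF Q(1)] linear_scale[OF inv] linear_scale[OF Q(1)])
  show "linear (split_A :: 'a \<times> 'b \<Rightarrow> _)"
    by (rule linearI) (simp_all add: split_A_def prod_eq_iff)
  show "split_J Q (split_J Q X) = - X" for X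
    by (simp add: split_J_def prod_eq_iff QQ linear_neg[OF Q(1)])
  show "split_A (split_A X) = X" for X :: "'a \<times> 'b" by (simp add: split_A_def)
  show "split_A (split_J Q X) = - split_J Q (split_A X)" for X
    by (simp add: split_J_def split_A_def linear_neg[OF inv])
  show "sum_form hp hm (split_J Q X) (split_J Q Y) = sum_form hp hm X Y" for X Y
    by (simp add: split_J_def sum_form_def bilinear_lneg[OF bp] bilinear_rneg[OF bp] QQ iso
        flip: iso[of "inv Q (snd X)"])
  show "sum_form hp hm (split_A X) (split_A Y) = sum_form hp hm X Y" for X Y
    by (simp add: split_A_def sum_form_def bilinear_lneg[OF bm] bilinear_rneg[OF bm])
qed

section \<open>The semidirect product defined by a flat connection\<close>

theorem corollary3p10:
  fixes brm :: "'m::real_vector \<Rightarrow> 'm \<Rightarrow> 'm"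
    and hm :: "'m \<Rightarrow> 'm \<Rightarrow> real"
    and brp :: "'p::real_vector \<Rightarrow> 'p \<Rightarrow> 'p"
    and hp :: "'p \<Rightarrow> 'p \<Rightarrow> real"
    and Q :: "'p \<Rightarrow> 'm"
    and \<phi> :: "'m \<Rightarrow> 'p \<Rightarrow> 'p"
    and n :: nat
  assumes "lie_algebra brm"
    and "flat_metric brm hm"
    and "dim (UNIV :: 'm set) = n"
    and "fin_dim TYPE('p)"
    and "dim (UNIV :: 'p set) = n"
    and "brp = abelian_bracket"
    and "linear Q" and "bij Q"
    and "hp = pullback_form Q hm"
    and "\<phi> = (\<lambda>x v. inv Q (levi_civita brm hm x (Q v)))"
  shows "born_data brp brm hp hm Q \<phi>
    \<and> lie_algebra (semidirect_bracket brp brm \<phi>)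
    \<and> born_structure (associated_born hp hm Q)
    \<and> integrable_born (semidirect_bracket brp brm \<phi>) (associated_born hp hm Q)
    \<and> flat_metric (semidirect_bracket brp brm \<phi>) (sum_form hp hm)"
proof -
  note la = assms(1) and Q = assms(7,8) and \<phi> = assms(10)
  let ?br = "semidirect_bracket brp brm \<phi>" and ?h = "sum_form hp hm"
  define N where "N = levi_civita brm hm"
  have hm: "pseudo_riemannian_metric hm" and flat: "curvature brm N x y z = 0" for x y z
    using assms(2) by (auto simp: flat_metric_def N_def)
  have hp: "pseudo_riemannian_metric hp"
    unfolding assms(9) by (rule pullback_form_metric[OF hm Q])
  have iso: "hm (Q x) (Q y) = hp x y" for x y by (simp add: assms(9) pullback_form_def)
  have bN: "bilinear N" and tN: "torsion_free brm N" and mN: "metric_connection hm N"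
    using levi_civita_bilinear[OF la hm] levi_civita_torsion_free[OF la hm]
      levi_civita_metric[OF la hm] by (auto simp: N_def)
  have inv: "linear (inv Q)"
    using Q by (rule linear_inv_bij)
  have QQ: "Q (inv Q z) = z" "inv Q (Q x) = x" for x z
    using Q(2) by (simp_all add: bij_is_surj surj_f_inv_f bij_is_inj)
  have \<phi>_eq: "\<phi> x v = inv Q (N x (Q v))" for x v by (simp add: \<phi> N_def)
  note lin = linear_add[OF inv] linear_add[OF Q(1)] linear_scale[OF inv] linear_scale[OF Q(1)]
    bilinear_ladd[OF bN] bilinear_radd[OF bN] bilinear_lmul[OF bN] bilinear_rmul[OF bN]
  have p: "lie_algebra brp"
    using assms(4) by (auto simp: assms(6) abelian_bracket_def lie_algebra_def
        intro!: bilinearI linearI)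
  have rep: "derivation_representation brm brp \<phi>"
    unfolding derivation_representation_def lie_derivation_def
  proof (intro conjI allI)
    show "linear (\<phi> x)" for x by (rule linearI) (simp_all add: \<phi>_eq lin)
    then show "\<phi> x (brp u v) = brp (\<phi> x u) v + brp u (\<phi> x v)" for x u v
      by (simp add: assms(6) abelian_bracket_def linear_0)
    show "linear (\<lambda>x. \<phi> x v)" for v by (rule linearI) (simp_all add: \<phi>_eq lin)
    show "\<phi> (brm x y) v = \<phi> x (\<phi> y v) - \<phi> y (\<phi> x v)" for x y v
      using flat[of x y "Q v"]
      by (simp add: \<phi>_eq QQ curvature_def flip: linear_diff[OF inv])
  qed
  \<comment> \<open>the Levi-Civita connection of \<open>h\<close>: on either summand a copy of \<open>\<nabla>\<close>, and zero along the
      abelian factor\<close>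
  define D where "D X Y = (\<phi> (snd X) (fst Y), N (snd X) (snd Y))" for X Y :: "'p \<times> 'm"
  have tD: "torsion_free ?br D"
    using tN by (auto simp: torsion_free_def D_def semidirect_bracket_def assms(6)
        abelian_bracket_def)
  have mD: "metric_connection ?h D"
    using mN
    by (simp add: metric_connection_def D_def sum_form_def \<phi>_eq QQ add_eq_0_iff flip: iso)
  have parJ: "D X (split_J Q Y) = split_J Q (D X Y)" for X Y
    by (simp add: D_def split_J_def \<phi>_eq QQ linear_neg[OF inv] linear_neg[OF Q(1)]
        bilinear_rneg[OF bN])
  have h: "pseudo_riemannian_metric ?h" by (rule sum_form_metric[OF hp hm])
  have "curvature ?br D X Y Z = 0" for X Y Z
    using flat[of "snd X" "snd Y" "snd Z"] rep
    by (simp add: curvature_def D_def semidirect_bracket_def derivation_representation_def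
        zero_prod_def)
  then have flat_h: "flat_metric ?br ?h"
    using h levi_civita_unique[OF h tD mD] by (simp add: flat_metric_def)
  interpret B: born_operators ?h "split_J Q" split_A
    by (rule born_operators_split[OF hp hm Q iso])
  have "integrable_born ?br (associated_born hp hm Q)"
    unfolding associated_born_def
    by (rule B.integrable_born_parallel[OF tD mD parJ lie_subalgebra_split_A[OF p la rep]])
  moreover have "born_structure (associated_born hp hm Q)"
    unfolding associated_born_def by (rule B.born_structure_encoded)
  moreover have "born_data brp brm hp hm Q \<phi>"
    using p la hp hm Q iso rep by (simp add: born_data_def)
  ultimately show ?thesis
    using lie_algebra_semidirect[OF p la rep] flat_h by blast
qed

end
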